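(* Let $R$ be a non-negative random variable with distribution $\mu$, let $\boldsymbol{\Omega}\sim N(\boldsymbol{0},\mathbf{1}_{d\times d})$ with $\mathbf{1}_{d\times d}\in\mathbb{R}^{d\times d}$ the identity matrix, let $U$ be uniformly distributed on $(0,1)$, let $\Phi$ be uniformly distributed on $(0,2\pi)$, and let $\boldsymbol{W}=(W_1,\dots,W_m)^\top$ be a centred $m$-variate Gaussian random field on $\mathbb{R}^l$ with pseudo-variogram $\boldsymbol{\gamma}=(\gamma_{ij})_{i,j=1,\dots,m}$, all independent. Then the $m$-variate random field $\boldsymbol{Z}=(Z_1,\dots,Z_m)^\top$ on $\mathbb{R}^d\times\mathbb{R}^l$ defined by $$Z_i(\boldsymbol{x},\boldsymbol{t})=\sqrt{-2\log(U)}\,\cos\left(\sqrt{2R}\,\langle\boldsymbol{\Omega},\boldsymbol{x}\rangle+\frac{\lVert\boldsymbol{\Omega}\rVert}{\sqrt2}W_i(\boldsymbol{t})+\Phi\right),\quad(\boldsymbol{x},\boldsymbol{t})\in\mathbb{R}^d\times\mathbb{R}^l,\ i=1,\dots,m,$$ has the extended Gneiting-type covariance function $$G_{ij}(\boldsymbol{h},\boldsymbol{u})=\frac{1}{(1+\gamma_{ij}(\boldsymbol{u}))^{d/2}}\,\varphi\left(\frac{\lVert\boldsymbol{h}\rVert^2}{1+\gamma_{ij}(\boldsymbol{u})}\right),\quad(\boldsymbol{h},\boldsymbol{u})\in\mathbb{R}^d\times\mathbb{R}^l,\ i,j=1,\dots,m,$$ where $\varphi$ denotes a bounded completely monotone 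function.
   Context: Here $d,l,m\in\mathbb{N}$. Random fields are real-vector-valued; $\lVert\cdot\rVert$ and $\langle\cdot,\cdot\rangle$ are the Euclidean norm and inner product. That $\boldsymbol{Z}$ has covariance function $(G_{ij})$ means $\mathrm{Cov}(Z_i(\boldsymbol{x}+\boldsymbol{h},\boldsymbol{t}+\boldsymbol{u}),Z_j(\boldsymbol{x},\boldsymbol{t}))=G_{ij}(\boldsymbol{h},\boldsymbol{u})$ for all arguments and all $i,j$. "Bounded completely monotone function" means the continuous extension $\varphi:[0,\infty)\to[0,\infty)$ of a bounded completely monotone function on $(0,\infty)$ (a $C^\infty$ function $\varphi$ with $(-1)^n\varphi^{(n)}\ge0$ for all $n\ge0$). An $m$-variate random field $\boldsymbol{W}$ on $\mathbb{R}^l$ is second-order stationary if it has constant mean and $\mathrm{Cov}(W_i(\boldsymbol{t}+\boldsymbol{u}),W_j(\boldsymbol{t}))$ exists and depends only on $\boldsymbol{u}$ for all $i,j$; it is intrinsically stationary if $\{\boldsymbol{W}(\boldsymbol{t}+\boldsymbol{u})-\boldsymbol{W}(\boldsymbol{t}),\ \boldsymbol{t}\in\mathbb{R}^l\}$ is second-order stationary for every $\boldsymbol{u}\in\mathbb{R}^l$. Pseudo-variogram: if $\boldsymbol{W}$ is intrinsically stationary and, additionally, $W_i(\boldsymbol{t}+\boldsymbol{u})-W_j(\boldsymbol{t})$ is square integrable with variance not depending on $\boldsymbol{t}$, for all $\boldsymbol{t},\boldsymbol{u}\in\mathbb{R}^l$, $i,j=1,\dots,m$, then the pseudo-variogram of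 $\boldsymbol{W}$ is $\gamma_{ij}(\boldsymbol{u})=\frac12\mathrm{Var}(W_i(\boldsymbol{t}+\boldsymbol{u})-W_j(\boldsymbol{t}))$. *)

theory Defs
  imports "HOL-Probability.Probability"
begin

section \<open>Bounded completely monotone functions\<close>

definition completely_monotone :: "(real \<Rightarrow> real) \<Rightarrow> bool" where
  "completely_monotone f \<longleftrightarrow>
     (\<forall>n. \<forall>x>0. ((deriv ^^ n) f) field_differentiable (at x)) \<and>
     (\<forall>n. \<forall>x>0. 0 \<le> (-1) ^ n * (deriv ^^ n) f x)"

text \<open>Functions on the half-line are total functions on the reals; only the values on
  \<open>{0..}\<close> matter. Continuity on \<open>{0..}\<close> makes \<open>f 0\<close> the continuous extension of the function
  on \<open>{0<..}\<close>.\<close>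

definition bounded_completely_monotone :: "(real \<Rightarrow> real) \<Rightarrow> bool" where
  "bounded_completely_monotone f \<longleftrightarrow>
     completely_monotone f \<and> bounded (f ` {0<..}) \<and>
     continuous_on {0..} f \<and> (\<forall>x\<ge>0. 0 \<le> f x)"


section \<open>Distributions\<close>

definition uniform_rv :: "'w measure \<Rightarrow> ('w \<Rightarrow> real) \<Rightarrow> real set \<Rightarrow> bool" where
  "uniform_rv M X A \<longleftrightarrow>
     X \<in> borel_measurable M \<and> distr M borel X = uniform_measure lborel A"

definition multi_normal_density ::
    "real ^ 'd \<Rightarrow> real ^ 'd ^ 'd \<Rightarrow> real ^ 'd::finite \<Rightarrow> real" where
  "multi_normal_density b \<Sigma> x =
     exp (- ((x - b) \<bullet> (matrix_inv \<Sigma> *v (x - b))) / 2)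
       / sqrt ((2 * pi) ^ CARD('d) * det \<Sigma>)"

text \<open>The case \<open>\<sigma> = 0\<close> is the point mass at \<open>b\<close>: the finite-dimensional distributions of a
  Gaussian random field may be degenerate.\<close>

definition normal_rv :: "'w measure \<Rightarrow> ('w \<Rightarrow> real) \<Rightarrow> bool" where
  "normal_rv M X \<longleftrightarrow> X \<in> borel_measurable M \<and>
     (\<exists>b \<sigma>. 0 \<le> \<sigma> \<and>
        distr M borel X =
          (if \<sigma> = 0 then return borel b else density lborel (normal_density b \<sigma>)))"


section \<open>Random fields\<close>

text \<open>An \<open>m\<close>-variate random field with index set \<open>'t\<close> is a map \<open>W :: 't \<Rightarrow> 'w \<Rightarrow> real ^ 'm\<close>.\<close>

definition random_field :: "'w measure \<Rightarrow> ('t \<Rightarrow> 'w \<Rightarrow> real ^ 'm::finite) \<Rightarrow> bool" where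
  "random_field M W \<longleftrightarrow> (\<forall>t. W t \<in> borel_measurable M)"

definition cov_exists :: "'w measure \<Rightarrow> ('w \<Rightarrow> real) \<Rightarrow> ('w \<Rightarrow> real) \<Rightarrow> bool" where
  "cov_exists M X Y \<longleftrightarrow>
     integrable M X \<and> integrable M Y \<and> integrable M (\<lambda>\<omega>. X \<omega> * Y \<omega>)"

definition cov :: "'w measure \<Rightarrow> ('w \<Rightarrow> real) \<Rightarrow> ('w \<Rightarrow> real) \<Rightarrow> real" where
  "cov M X Y =
     (LINT \<omega>|M. (X \<omega> - (LINT \<omega>'|M. X \<omega>')) * (Y \<omega> - (LINT \<omega>'|M. Y \<omega>')))"

definition has_covariance_function ::
    "'w measure \<Rightarrow> ('t::plus \<Rightarrow> 'w \<Rightarrow> real ^ 'm::finite) \<Rightarrow> ('m \<Rightarrow> 'm \<Rightarrow> 't \<Rightarrow> real) \<Rightarrow> bool" where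
  "has_covariance_function M W G \<longleftrightarrow> (\<forall>i j t u.
     cov_exists M (\<lambda>\<omega>. W (t + u) \<omega> $ i) (\<lambda>\<omega>. W t \<omega> $ j) \<and>
     cov M (\<lambda>\<omega>. W (t + u) \<omega> $ i) (\<lambda>\<omega>. W t \<omega> $ j) = G i j u)"

definition second_order_stationary ::
    "'w measure \<Rightarrow> (real ^ 'l::finite \<Rightarrow> 'w \<Rightarrow> real ^ 'm::finite) \<Rightarrow> bool" where
  "second_order_stationary M W \<longleftrightarrow> random_field M W \<and>
     (\<forall>i. \<exists>c. \<forall>t. integrable M (\<lambda>\<omega>. W t \<omega> $ i) \<and> (LINT \<omega>|M. W t \<omega> $ i) = c) \<and>
     (\<exists>C. has_covariance_function M W C)"

definition intrinsically_stationary ::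
    "'w measure \<Rightarrow> (real ^ 'l::finite \<Rightarrow> 'w \<Rightarrow> real ^ 'm::finite) \<Rightarrow> bool" where
  "intrinsically_stationary M W \<longleftrightarrow> random_field M W \<and>
     (\<forall>u. second_order_stationary M (\<lambda>t \<omega>. W (t + u) \<omega> - W t \<omega>))"

text \<open>The equation for \<open>\<gamma>\<close> is required for every \<open>t\<close>, so it contains the requirement that the
  variance does not depend on \<open>t\<close>.\<close>

definition has_pseudo_variogram ::
    "'w measure \<Rightarrow> (real ^ 'l::finite \<Rightarrow> 'w \<Rightarrow> real ^ 'm::finite) \<Rightarrow>
     ('m \<Rightarrow> 'm \<Rightarrow> real ^ 'l \<Rightarrow> real) \<Rightarrow> bool" where
  "has_pseudo_variogram M W \<gamma> \<longleftrightarrow> intrinsically_stationary M W \<and>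
     (\<forall>i j t u.
        integrable M (\<lambda>\<omega>. (W (t + u) \<omega> $ i - W t \<omega> $ j)\<^sup>2) \<and>
        \<gamma> i j u = prob_space.variance M (\<lambda>\<omega>. W (t + u) \<omega> $ i - W t \<omega> $ j) / 2)"

text \<open>A random vector is (possibly degenerate) multivariate normal iff all linear functionals of it
  are univariate normal; here this is imposed on \<open>(W t)\<^bsub>t \<in> T\<^esub>\<close> for every finite \<open>T\<close>.\<close>

definition gaussian_field ::
    "'w measure \<Rightarrow> ('t \<Rightarrow> 'w \<Rightarrow> real ^ 'm::finite) \<Rightarrow> bool" where
  "gaussian_field M W \<longleftrightarrow> random_field M W \<and>
     (\<forall>T a. finite T \<longrightarrow> normal_rv M (\<lambda>\<omega>. \<Sum>t\<in>T. a t \<bullet> W t \<omega>))"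

definition centred_field ::
    "'w measure \<Rightarrow> ('t \<Rightarrow> 'w \<Rightarrow> real ^ 'm::finite) \<Rightarrow> bool" where
  "centred_field M W \<longleftrightarrow>
     (\<forall>t i. integrable M (\<lambda>\<omega>. W t \<omega> $ i) \<and> (LINT \<omega>|M. W t \<omega> $ i) = 0)"


section \<open>Independence\<close>

text \<open>\<open>generated_events M N X\<close> is the sigma-algebra on \<open>space M\<close> generated by \<open>X\<close> as a map into
  \<open>N\<close>. The random objects below take values in different types, so \<open>prob_space.indep_vars\<close> does
  not apply to them; independence is that of the generated sigma-algebras. For a random field it
  is the sigma-algebra generated by all its values, that is, by the field as a map into the
  product space.\<close>

definition generated_events :: "'w measure \<Rightarrow> 'b measure \<Rightarrow> ('w \<Rightarrow> 'b) \<Rightarrow> 'w set set" where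
  "generated_events M N X = {X -` A \<inter> space M | A. A \<in> sets N}"

definition field_events :: "'w measure \<Rightarrow> ('t \<Rightarrow> 'w \<Rightarrow> real ^ 'm::finite) \<Rightarrow> 'w set set" where
  "field_events M W = generated_events M (PiM UNIV (\<lambda>_. borel)) (\<lambda>\<omega> t. W t \<omega>)"

definition independent_families :: "'w measure \<Rightarrow> 'w set set list \<Rightarrow> bool" where
  "independent_families M Fs \<longleftrightarrow> prob_space.indep_sets M (\<lambda>k. Fs ! k) {..<length Fs}"


section \<open>Covariance functions of extended Gneiting type\<close>

definition extended_gneiting ::
    "(real \<Rightarrow> real) \<Rightarrow> ('m \<Rightarrow> 'm \<Rightarrow> real ^ 'l \<Rightarrow> real) \<Rightarrow>
     'm \<Rightarrow> 'm \<Rightarrow> (real ^ 'd::finite) \<times> (real ^ 'l::finite) \<Rightarrow> real" where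
  "extended_gneiting \<phi> \<gamma> i j = (\<lambda>(h, u).
     1 / (1 + \<gamma> i j u) powr (real CARD('d) / 2) * \<phi> ((norm h)\<^sup>2 / (1 + \<gamma> i j u)))"

end

theory Submission
  imports Defs
begin

text \<open>The covariance is found by averaging over one source of randomness at a time, which
  independence permits by Fubini's theorem (\<open>indep_rv_expectation\<close>). Fix two points
  \<open>(x + h, t + u)\<close> and \<open>(x, t)\<close> and components \<open>i, j\<close>, and let \<open>A\<close> and \<open>B\<close> be the arguments of
  the cosine in \<open>Z\<^sub>i (x + h, t + u)\<close> and \<open>Z\<^sub>j (x, t)\<close> without the phase \<open>\<Phi>\<close>.

  \<^item> \<open>U\<close>: \<open>- ln U\<close> is exponentially distributed with mean \<open>1\<close>, so the squared amplitude
    has mean \<open>2\<close>.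
  \<^item> \<open>\<Phi>\<close>: since \<open>2 cos (A + \<Phi>) cos (B + \<Phi>) = cos (A - B) + cos (A + B + 2 \<Phi>)\<close>, and a cosine
    averages to zero over full periods, what remains is \<open>cos (A - B) / 2\<close>. For the same reason
    \<open>Z\<close> is centred. Together with the factor \<open>2\<close> the covariance is the mean of \<open>cos (A - B)\<close>
    (\<open>random_wave_covariance\<close>).
  \<^item> \<open>W\<close>: it enters \<open>A - B\<close> only through \<open>D = W\<^sub>i (t + u) - W\<^sub>j t\<close>, which is centred normal with
    variance \<open>2 \<gamma>\<^sub>i\<^sub>j u\<close>. Its characteristic function at \<open>norm \<Omega> / sqrt 2\<close> is
    \<open>exp (- \<gamma>\<^sub>i\<^sub>j u * (norm \<Omega>)\<^sup>2 / 2)\<close>.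
  \<^item> \<open>\<Omega>\<close>: this factor turns the weight \<open>exp (- (norm w)\<^sup>2 / 2)\<close> of the standard normal density
    into \<open>exp (- (1 + \<gamma>\<^sub>i\<^sub>j u) * (norm w)\<^sup>2 / 2)\<close>. With the constant of the standard normal
    density, the Fourier transform of the latter at \<open>sqrt (2 R) h\<close> is
    \<open>(1 + \<gamma>\<^sub>i\<^sub>j u) powr (- d / 2) * exp (- R * (norm h)\<^sup>2 / (1 + \<gamma>\<^sub>i\<^sub>j u))\<close>,
    which is where the shape of the Gneiting class comes from
    (\<open>gaussian_mixture_spectral_average\<close>).
  \<^item> \<open>R\<close>: the mean over \<open>R\<close> is the Laplace transform of the law \<open>\<mu>\<close> at
    \<open>(norm h)\<^sup>2 / (1 + \<gamma>\<^sub>i\<^sub>j u)\<close>. So \<open>\<phi>\<close> is the Laplace transform of \<open>\<mu>\<close>. That such a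
    transform is bounded and completely monotone is the easy half of Bernstein's theorem
    (\<open>laplace_transform_bounded_completely_monotone\<close>).\<close>

section \<open>Independence of random elements with different value types\<close>

text \<open>Independence of two random elements whose value types differ, expressed by the
  factorization of their joint law because that is the form in which Fubini's theorem uses it.\<close>
definition indep_rv ::
    "'w measure \<Rightarrow> 'a measure \<Rightarrow> ('w \<Rightarrow> 'a) \<Rightarrow> 'b measure \<Rightarrow> ('w \<Rightarrow> 'b) \<Rightarrow> bool" where
  "indep_rv M S X T Y \<longleftrightarrow> X \<in> measurable M S \<and> Y \<in> measurable M T \<and>
     distr M (S \<Otimes>\<^sub>M T) (\<lambda>\<omega>. (X \<omega>, Y \<omega>)) = distr M S X \<Otimes>\<^sub>M distr M T Y"

text \<open>Grouping: the sigma-algebras generated by two disjoint groups of independent families are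
  independent, so any two random elements built from the two groups have a product law.\<close>
lemma (in prob_space) indep_rv_if_indep_sets:
  fixes F :: "'i \<Rightarrow> 'a set set"
  assumes indep: "indep_sets F I"
    and Int_stable: "\<And>i. i \<in> I \<Longrightarrow> Int_stable (F i)"
    and JK: "J \<union> K \<subseteq> I" "J \<inter> K = {}"
    and X: "X \<in> measurable (sigma (space M) (\<Union>i\<in>J. F i)) S"
    and Y: "Y \<in> measurable (sigma (space M) (\<Union>i\<in>K. F i)) T"
  shows "indep_rv M S X T Y"
proof -
  have F: "F i \<subseteq> events" if "i \<in> I" for i
    using indep that by (auto simp: indep_sets_def)
  have Fsub: "(\<Union>i\<in>L. F i) \<subseteq> Pow (space M)" "(\<Union>i\<in>L. F i) \<subseteq> events" if "L \<subseteq> I" for L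
    using F that sets.space_closed by (blast, blast)
  have subJ: "(\<Union>i\<in>J. F i) \<subseteq> Pow (space M)" and subK: "(\<Union>i\<in>K. F i) \<subseteq> Pow (space M)"
    using Fsub JK by auto
  have split_eq: "(\<Union>b. case_bool J K b) = J \<union> K"
    by (auto simp: UNIV_bool)
  have "indep_sets (\<lambda>b. sigma_sets (space M) (\<Union>i\<in>case_bool J K b. F i)) UNIV"
  proof (rule indep_sets_collect_sigma)
    show "indep_sets F (\<Union>b. case_bool J K b)"
      unfolding split_eq by (rule indep_sets_mono_index[OF JK(1) indep])
    show "Int_stable (F i)" if "i \<in> case_bool J K b" for i b
      using that JK Int_stable by (auto split: bool.splits)
    show "disjoint_family (case_bool J K)"
      using JK(2) by (auto simp: disjoint_family_on_def split: bool.split)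
  qed
  moreover have "(\<lambda>b. sigma_sets (space M) (\<Union>i\<in>case_bool J K b. F i)) =
      case_bool (sigma_sets (space M) (\<Union>i\<in>J. F i)) (sigma_sets (space M) (\<Union>i\<in>K. F i))"
    by (auto simp: fun_eq_iff split: bool.split)
  ultimately have sep: "indep_set (sigma_sets (space M) (\<Union>i\<in>J. F i))
      (sigma_sets (space M) (\<Union>i\<in>K. F i))"
    by (simp add: indep_set_def)
  have setsJ: "sets (sigma (space M) (\<Union>i\<in>J. F i)) \<subseteq> events"
    using Fsub(2)[of J] JK subJ by (simp add: sets.sigma_sets_subset)
  have setsK: "sets (sigma (space M) (\<Union>i\<in>K. F i)) \<subseteq> events"
    using Fsub(2)[of K] JK subK by (simp add: sets.sigma_sets_subset)
  have X'[measurable]: "X \<in> measurable M S"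
    using X setsJ subJ by (auto simp: measurable_def)
  have Y'[measurable]: "Y \<in> measurable M T"
    using Y setsK subK by (auto simp: measurable_def)
  interpret PX: prob_space "distr M S X" by (rule prob_space_distr) simp
  interpret PY: prob_space "distr M T Y" by (rule prob_space_distr) simp
  have "distr M S X \<Otimes>\<^sub>M distr M T Y = distr M (S \<Otimes>\<^sub>M T) (\<lambda>\<omega>. (X \<omega>, Y \<omega>))"
  proof (rule pair_measure_eqI)
    show "sigma_finite_measure (distr M S X)" "sigma_finite_measure (distr M T Y)"
      by unfold_locales
    show "sets (distr M S X \<Otimes>\<^sub>M distr M T Y) = sets (distr M (S \<Otimes>\<^sub>M T) (\<lambda>\<omega>. (X \<omega>, Y \<omega>)))"
      by (simp cong: sets_pair_measure_cong)
    fix A B assume "A \<in> sets (distr M S X)" "B \<in> sets (distr M T Y)"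
    then have A[measurable]: "A \<in> sets S" and B[measurable]: "B \<in> sets T" by auto
    have "X -` A \<inter> space M \<in> sigma_sets (space M) (\<Union>i\<in>J. F i)"
      using measurable_sets[OF X A] subJ by simp
    moreover have "Y -` B \<inter> space M \<in> sigma_sets (space M) (\<Union>i\<in>K. F i)"
      using measurable_sets[OF Y B] subK by simp
    ultimately have "prob ((X -` A \<inter> space M) \<inter> (Y -` B \<inter> space M)) =
        prob (X -` A \<inter> space M) * prob (Y -` B \<inter> space M)"
      by (rule indep_setD[OF sep])
    moreover have "(\<lambda>\<omega>. (X \<omega>, Y \<omega>)) -` (A \<times> B) \<inter> space M =
        (X -` A \<inter> space M) \<inter> (Y -` B \<inter> space M)"
      by auto
    ultimately show "emeasure (distr M S X) A * emeasure (distr M T Y) B =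
        emeasure (distr M (S \<Otimes>\<^sub>M T) (\<lambda>\<omega>. (X \<omega>, Y \<omega>))) (A \<times> B)"
      by (simp add: emeasure_distr emeasure_eq_measure ennreal_mult[symmetric] del: vimage_Int)
  qed
  then show ?thesis by (simp add: indep_rv_def)
qed

text \<open>One argument is averaged out while the other is kept fixed. Writing the outer mean over
  \<open>M\<close> again, and not over the law of \<open>Y\<close>, lets the lemma be iterated.\<close>
lemma (in prob_space) indep_rv_expectation:
  fixes f :: "'b \<Rightarrow> 'c \<Rightarrow> real"
  assumes indep: "indep_rv M S X T Y"
    and f[measurable]: "case_prod f \<in> borel_measurable (S \<Otimes>\<^sub>M T)"
    and bounded: "\<And>x y. \<bar>f x y\<bar> \<le> B"
  shows "expectation (\<lambda>\<omega>. f (X \<omega>) (Y \<omega>)) =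
    expectation (\<lambda>\<omega>'. expectation (\<lambda>\<omega>. f (X \<omega>) (Y \<omega>')))"
proof -
  have [measurable]: "X \<in> measurable M S" "Y \<in> measurable M T"
    and law: "distr M (S \<Otimes>\<^sub>M T) (\<lambda>\<omega>. (X \<omega>, Y \<omega>)) = distr M S X \<Otimes>\<^sub>M distr M T Y"
    using indep by (auto simp: indep_rv_def)
  interpret PX: prob_space "distr M S X" by (rule prob_space_distr) simp
  interpret PY: prob_space "distr M T Y" by (rule prob_space_distr) simp
  interpret P: pair_prob_space "distr M S X" "distr M T Y" ..
  have int: "integrable (distr M S X \<Otimes>\<^sub>M distr M T Y) (case_prod f)"
    by (rule P.integrable_const_bound[where B=B])
       (use bounded in \<open>auto simp: split_beta'\<close>)
  have "expectation (\<lambda>\<omega>. f (X \<omega>) (Y \<omega>)) =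
      (\<integral>z. case_prod f z \<partial>distr M (S \<Otimes>\<^sub>M T) (\<lambda>\<omega>. (X \<omega>, Y \<omega>)))"
    by (subst integral_distr) auto
  also have "\<dots> = (\<integral>y. (\<integral>x. f x y \<partial>distr M S X) \<partial>distr M T Y)"
    unfolding law by (rule P.integral_snd[OF int, symmetric])
  also have "\<dots> = (\<integral>\<omega>'. (\<integral>x. f x (Y \<omega>') \<partial>distr M S X) \<partial>M)"
    by (rule integral_distr) auto
  also have "\<dots> = (\<integral>\<omega>'. (\<integral>\<omega>. f (X \<omega>) (Y \<omega>') \<partial>M) \<partial>M)"
  proof (rule Bochner_Integration.integral_cong[OF refl])
    fix \<omega>' assume [measurable]: "\<omega>' \<in> space M"
    have "Y \<omega>' \<in> space T" by (rule measurable_space) auto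
    then show "(\<integral>x. f x (Y \<omega>') \<partial>distr M S X) = (\<integral>\<omega>. f (X \<omega>) (Y \<omega>') \<partial>M)"
      by (intro integral_distr) auto
  qed
  finally show ?thesis .
qed

lemma generated_events_Int_stable: "Int_stable (generated_events M N X)"
proof (rule Int_stableI)
  fix a b assume "a \<in> generated_events M N X" "b \<in> generated_events M N X"
  then obtain A B where "a = X -` A \<inter> space M" "A \<in> sets N" "b = X -` B \<inter> space M" "B \<in> sets N"
    by (auto simp: generated_events_def)
  then have "a \<inter> b = X -` (A \<inter> B) \<inter> space M" "A \<inter> B \<in> sets N" by auto
  then show "a \<inter> b \<in> generated_events M N X"
    unfolding generated_events_def by blast
qed

text \<open>This gives access to the sigma-algebra generated by a whole group of families: measurability
  of a compound expression with respect to it then follows from that of its parts.\<close>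
lemma measurable_sigma_generated_events:
  assumes "generated_events M N X \<subseteq> E" "E \<subseteq> Pow (space M)" "X \<in> space M \<rightarrow> space N"
  shows "X \<in> measurable (sigma (space M) E) N"
  using assms by (auto simp: measurable_def generated_events_def intro!: sigma_sets.Basic)

lemma (in prob_space) indep_rv_compose_right:
  assumes indep: "indep_rv M S X T Y" and g[measurable]: "g \<in> measurable T T'"
  shows "indep_rv M S X T' (\<lambda>\<omega>. g (Y \<omega>))"
proof -
  have [measurable]: "X \<in> measurable M S" "Y \<in> measurable M T"
    and law: "distr M (S \<Otimes>\<^sub>M T) (\<lambda>\<omega>. (X \<omega>, Y \<omega>)) = distr M S X \<Otimes>\<^sub>M distr M T Y"
    using indep by (auto simp: indep_rv_def)
  have gY: "distr (distr M T Y) T' g = distr M T' (\<lambda>\<omega>. g (Y \<omega>))"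
    by (simp add: distr_distr comp_def)
  interpret P: prob_space "distr M T' (\<lambda>\<omega>. g (Y \<omega>))" by (rule prob_space_distr) simp
  have "distr M (S \<Otimes>\<^sub>M T') (\<lambda>\<omega>. (X \<omega>, g (Y \<omega>))) =
      distr (distr M (S \<Otimes>\<^sub>M T) (\<lambda>\<omega>. (X \<omega>, Y \<omega>))) (S \<Otimes>\<^sub>M T') (\<lambda>(x, y). (x, g y))"
    by (subst distr_distr) (auto simp: comp_def)
  also have "\<dots> = distr (distr M S X) S (\<lambda>x. x) \<Otimes>\<^sub>M distr (distr M T Y) T' g"
    unfolding law
    by (rule pair_measure_distr[symmetric])
       (auto simp: gY intro: P.sigma_finite_measure_axioms)
  also have "distr (distr M S X) S (\<lambda>x. x) = distr M S X"
    using distr_cong[of "distr M S X" "distr M S X" S "distr M S X" "\<lambda>x. x" "\<lambda>x. x"]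
    by (simp add: distr_id)
  finally show ?thesis by (simp add: indep_rv_def gY)
qed

lemma (in prob_space) indep_rv_product:
  fixes X Y :: "'a \<Rightarrow> real"
  assumes indep: "indep_rv M borel X borel Y" and "integrable M X" "integrable M Y"
  shows "integrable M (\<lambda>\<omega>. X \<omega> * Y \<omega>)"
    and "expectation (\<lambda>\<omega>. X \<omega> * Y \<omega>) = expectation X * expectation Y"
proof -
  have "indep_var borel X borel Y"
    using indep by (auto simp: indep_rv_def indep_var_distribution_eq)
  then show "integrable M (\<lambda>\<omega>. X \<omega> * Y \<omega>)"
    "expectation (\<lambda>\<omega>. X \<omega> * Y \<omega>) = expectation X * expectation Y"
    using assms by (auto intro: indep_var_integrable indep_var_lebesgue_integral)
qed

lemma (in prob_space) indep_rv_sym: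
  assumes "indep_rv M S X T Y" shows "indep_rv M T Y S X"
proof -
  have [measurable]: "X \<in> measurable M S" "Y \<in> measurable M T"
    and law: "distr M (S \<Otimes>\<^sub>M T) (\<lambda>\<omega>. (X \<omega>, Y \<omega>)) = distr M S X \<Otimes>\<^sub>M distr M T Y"
    using assms by (auto simp: indep_rv_def)
  interpret PX: prob_space "distr M S X" by (rule prob_space_distr) simp
  interpret PY: prob_space "distr M T Y" by (rule prob_space_distr) simp
  interpret P: pair_prob_space "distr M T Y" "distr M S X" ..
  have "distr M T Y \<Otimes>\<^sub>M distr M S X =
      distr (distr M S X \<Otimes>\<^sub>M distr M T Y) (distr M T Y \<Otimes>\<^sub>M distr M S X) (\<lambda>(x, y). (y, x))"
    by (rule P.distr_pair_swap)
  also have "\<dots> = distr (distr M (S \<Otimes>\<^sub>M T) (\<lambda>\<omega>. (X \<omega>, Y \<omega>))) (T \<Otimes>\<^sub>M S) (\<lambda>(x, y). (y, x))"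
    unfolding law by (rule distr_cong) (auto cong: sets_pair_measure_cong)
  also have "\<dots> = distr M (T \<Otimes>\<^sub>M S) (\<lambda>\<omega>. (Y \<omega>, X \<omega>))"
    by (subst distr_distr) (auto simp: comp_def)
  finally show ?thesis by (simp add: indep_rv_def)
qed


section \<open>Gaussian Fourier transforms\<close>

lemma complex_integrable_std_normal_iexp:
  "complex_integrable std_normal_distribution (\<lambda>x. iexp (t * x))"
proof -
  interpret real_distribution std_normal_distribution by (rule real_dist_normal_dist)
  show ?thesis by (rule integrable_iexp) auto
qed

text \<open>The real part of the characteristic function, rotated by the angle \<open>a\<close>.\<close>
lemma std_normal_distribution_cos:
  "(LINT x|std_normal_distribution. cos (a + t * x)) = cos a * exp (- (t\<^sup>2) / 2)"
proof -
  have "(LINT x|std_normal_distribution. cos (a + t * x)) =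
      (LINT x|std_normal_distribution. Re (iexp a * iexp (t * x)))"
    by (intro Bochner_Integration.integral_cong refl)
       (simp add: exp_add[symmetric] distrib_left[symmetric] Re_exp)
  also have "\<dots> = Re (CLINT x|std_normal_distribution. iexp a * iexp (t * x))"
    by (rule integral_Re) (intro integrable_mult_right complex_integrable_std_normal_iexp)
  also have "(CLINT x|std_normal_distribution. iexp a * iexp (t * x)) =
      iexp a * exp (- (t\<^sup>2) / 2)"
    using fun_cong[OF char_std_normal_distribution, of t] by (simp add: char_def)
  also have "Re \<dots> = cos a * exp (- (t\<^sup>2) / 2)"
    by (simp add: Re_exp)
  finally show ?thesis .
qed

text \<open>After scaling by the standard deviation this is the preceding formula. The point mass has to
  be treated separately; it occurs, for instance, when \<open>X\<close> is the difference of one and the same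
  component of a field at one and the same point.\<close>
lemma (in prob_space) expectation_cos_centred_normal:
  assumes normal: "normal_rv M X" and centred: "expectation X = 0"
  shows "expectation (\<lambda>\<omega>. cos (a + b * X \<omega>)) = cos a * exp (- (b\<^sup>2 * variance X / 2))"
proof -
  have [measurable]: "X \<in> borel_measurable M" using normal by (simp add: normal_rv_def)
  obtain m s where s: "0 \<le> s" and law: "distr M borel X =
      (if s = 0 then return borel m else density lborel (normal_density m s))"
    using normal by (auto simp: normal_rv_def)
  show ?thesis
  proof (cases "s = 0")
    case True
    have *: "expectation (\<lambda>\<omega>. f (X \<omega>)) = f m" if [measurable]: "f \<in> borel_measurable borel"
      for f :: "real \<Rightarrow> real"
    proof -
      have "expectation (\<lambda>\<omega>. f (X \<omega>)) = (LINT x|distr M borel X. f x)"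
        by (rule integral_distr[symmetric]) auto
      also have "\<dots> = f m" using law True by (simp add: integral_return)
      finally show ?thesis .
    qed
    have "m = 0" using *[of "\<lambda>x. x"] centred by simp
    then show ?thesis using *[of "\<lambda>x. x\<^sup>2"] *[of "\<lambda>x. cos (a + b * x)"] centred by simp
  next
    case False
    then have s: "0 < s" using s by simp
    have D: "distributed M lborel X (normal_density m s)"
    proof -
      have "distr M lborel X = distr M borel X" by (rule distr_cong) auto
      then show ?thesis using law False by (simp add: distributed_def)
    qed
    have m: "m = 0" using normal_distributed_expectation[OF s D] centred by simp
    have var: "variance X = s\<^sup>2" by (rule normal_distributed_variance[OF s D])
    have std: "distributed M lborel (\<lambda>\<omega>. X \<omega> / s) std_normal_density"
      using D normal_standard_normal_convert[OF s, of X m] m by simp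
    have "expectation (\<lambda>\<omega>. cos (a + b * X \<omega>)) = expectation (\<lambda>\<omega>. cos (a + (b * s) * (X \<omega> / s)))"
      using s by simp
    also have "\<dots> = (LINT x|lborel. std_normal_density x * cos (a + (b * s) * x))"
      by (rule distributed_integral[OF std, symmetric]) auto
    also have "\<dots> = (LINT x|std_normal_distribution. cos (a + (b * s) * x))"
      by (subst integral_density) auto
    also have "\<dots> = cos a * exp (- (b\<^sup>2 * variance X / 2))"
      unfolding var std_normal_distribution_cos by (simp add: power_mult_distrib)
    finally show ?thesis .
  qed
qed

lemma matrix_inv_mat_1: "matrix_inv (mat 1 :: real ^ 'n ^ 'n) = mat 1"
proof -
  have "mat 1 ** matrix_inv (mat 1 :: real ^ 'n ^ 'n) = mat 1"
    unfolding matrix_inv_def by (rule someI2[of _ "mat 1"]) auto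
  then show ?thesis by simp
qed

text \<open>The substitution \<open>y = sqrt c * x\<close> reduces the one-dimensional Gaussian Fourier integral to the
  characteristic function of the standard normal distribution. The factor \<open>1 / sqrt (2 * pi)\<close> is
  kept so that products over coordinates give the standard normal density on \<open>real ^ 'd\<close>.\<close>
lemma gaussian_line_integral:
  assumes "0 < c"
  shows "complex_integrable lborel (\<lambda>x. iexp (t * x) * exp (- (c * x\<^sup>2) / 2) / sqrt (2 * pi))"
    and "(CLINT x|lborel. iexp (t * x) * exp (- (c * x\<^sup>2) / 2) / sqrt (2 * pi)) =
      exp (- (t\<^sup>2) / (2 * c)) / sqrt c"
proof -
  define g where "g y = std_normal_density y *\<^sub>R iexp (t / sqrt c * y)" for y
  have g: "complex_integrable lborel g" "(CLINT y|lborel. g y) = exp (- (t\<^sup>2) / (2 * c))"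
  proof -
    have "complex_integrable std_normal_distribution (\<lambda>x. iexp (t / sqrt c * x))"
      by (rule complex_integrable_std_normal_iexp)
    then show "complex_integrable lborel g"
      unfolding g_def by (subst (asm) integrable_density) auto
    have "(CLINT y|lborel. g y) = char std_normal_distribution (t / sqrt c)"
      unfolding g_def char_def by (subst integral_density) auto
    also have "\<dots> = exp (- (t\<^sup>2) / (2 * c))"
      using assms by (simp add: char_std_normal_distribution power_divide mult.commute)
    finally show "(CLINT y|lborel. g y) = exp (- (t\<^sup>2) / (2 * c))" .
  qed
  have eq: "iexp (t * x) * exp (- (c * x\<^sup>2) / 2) / sqrt (2 * pi) = g (0 + sqrt c * x)" for x
    using assms by (simp add: g_def std_normal_density_def scaleR_conv_of_real power_mult_distrib
        exp_of_real[symmetric])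
  show "complex_integrable lborel (\<lambda>x. iexp (t * x) * exp (- (c * x\<^sup>2) / 2) / sqrt (2 * pi))"
    unfolding eq using assms g by (intro lborel_integrable_real_affine) auto
  have "(CLINT y|lborel. g y) = \<bar>sqrt c\<bar> *\<^sub>R (CLINT x|lborel. g (0 + sqrt c * x))"
    by (rule lborel_integral_real_affine) (use assms in auto)
  then show "(CLINT x|lborel. iexp (t * x) * exp (- (c * x\<^sup>2) / 2) / sqrt (2 * pi)) =
      exp (- (t\<^sup>2) / (2 * c)) / sqrt c"
    unfolding eq using assms g by (simp add: scaleR_conv_of_real field_simps)
qed

text \<open>The integrand is a product of functions of one coordinate each, so the integral is the product
  of one-dimensional ones. The scalar product is kept inside a complex exponential because the
  cosine of a sum does not factorize.\<close>
lemma gaussian_integral_iexp: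
  fixes h :: "real ^ 'd::finite"
  assumes c: "0 < c"
  shows "complex_integrable lborel
      (\<lambda>x. iexp (h \<bullet> x) * exp (- (c * (norm x)\<^sup>2) / 2) / sqrt (2 * pi) ^ CARD('d))" (is ?int)
    and "(CLINT x|lborel. iexp (h \<bullet> x) * exp (- (c * (norm x)\<^sup>2) / 2) / sqrt (2 * pi) ^ CARD('d)) =
      exp (- (norm h)\<^sup>2 / (2 * c)) / c powr (real CARD('d) / 2)" (is ?eq)
proof -
  define f :: "real ^ 'd \<Rightarrow> real \<Rightarrow> complex" where
    "f b y = iexp ((h \<bullet> b) * y) * exp (- (c * y\<^sup>2) / 2) / sqrt (2 * pi)" for b y
  have card: "card (Basis :: (real ^ 'd) set) = CARD('d)" by simp
  have norm_sq: "(norm x)\<^sup>2 = (\<Sum>b\<in>Basis. (x \<bullet> b)\<^sup>2)" for x :: "real ^ 'd"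
    by (subst power2_norm_eq_inner) (subst euclidean_inner, simp add: power2_eq_square)
  have prod_f: "iexp (h \<bullet> x) * exp (- (c * (norm x)\<^sup>2) / 2) / sqrt (2 * pi) ^ CARD('d) =
      (\<Prod>b\<in>Basis. f b (x \<bullet> b))" for x :: "real ^ 'd"
  proof -
    have "iexp (h \<bullet> x) = (\<Prod>b\<in>Basis. iexp ((h \<bullet> b) * (x \<bullet> b)))"
      by (subst euclidean_inner) (simp add: exp_sum sum_distrib_left)
    moreover have "exp (- (c * (norm x)\<^sup>2) / 2) = (\<Prod>b\<in>Basis. exp (- (c * (x \<bullet> b)\<^sup>2) / 2))"
      by (simp add: norm_sq exp_sum[symmetric] sum_distrib_left sum_negf sum_divide_distrib)
    ultimately show ?thesis
      by (simp add: f_def prod.distrib prod_dividef card)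
  qed
  interpret L: product_sigma_finite "\<lambda>_ :: real ^ 'd. lborel :: real measure" ..
  have f_int: "complex_integrable lborel (f b)" for b
    unfolding f_def by (rule gaussian_line_integral(1)[OF c])
  have [measurable]: "f b \<in> borel_measurable borel" for b unfolding f_def by measurable
  have coord: "(\<Prod>b\<in>Basis. f b ((\<Sum>b'\<in>Basis. y b' *\<^sub>R b') \<bullet> b)) = (\<Prod>b\<in>Basis. f b (y b))" for y
    by (intro prod.cong refl) simp
  have int: "complex_integrable (\<Pi>\<^sub>M b\<in>Basis. lborel) (\<lambda>y. \<Prod>b\<in>Basis. f b (y b))"
    by (rule L.product_integrable_prod) (use f_int in auto)
  have meas: "(\<lambda>x :: real ^ 'd. \<Prod>b\<in>Basis. f b (x \<bullet> b)) \<in> borel_measurable borel" by measurable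
  show ?int
    unfolding prod_f by (subst lborel_eq, subst integrable_distr_eq) (use int meas in \<open>simp_all add: coord\<close>)
  have "(CLINT x|lborel. \<Prod>b\<in>Basis. f b (x \<bullet> b)) =
      (CLINT y|(\<Pi>\<^sub>M b\<in>Basis. lborel). \<Prod>b\<in>Basis. f b (y b))"
    by (subst lborel_eq, subst integral_distr) (use meas in \<open>simp_all add: coord\<close>)
  also have "\<dots> = (\<Prod>b\<in>Basis. CLINT y|lborel. f b y)"
    by (rule L.product_integral_prod) (use f_int in auto)
  also have "\<dots> = (\<Prod>b\<in>Basis. complex_of_real (exp (- (h \<bullet> b)\<^sup>2 / (2 * c)) / sqrt c))"
    unfolding f_def by (intro prod.cong refl) (rule gaussian_line_integral(2)[OF c])
  also have "\<dots> = complex_of_real (exp (- (norm h)\<^sup>2 / (2 * c)) / sqrt c ^ CARD('d))"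
    by (simp add: prod_dividef norm_sq exp_sum[symmetric] sum_negf sum_divide_distrib card
        flip: of_real_prod)
  also have "sqrt c ^ CARD('d) = c powr (real CARD('d) / 2)"
    using c by (simp add: powr_half_sqrt[symmetric] powr_realpow[symmetric] powr_powr)
  finally show ?eq unfolding prod_f .
qed

text \<open>The extra Gaussian factor is absorbed into the normal density, which changes the weight from
  \<open>1\<close> to \<open>1 + g\<close>; what is left is the real part of a Gaussian Fourier transform.\<close>
lemma (in prob_space) expectation_cos_exp_std_normal_vector:
  fixes X :: "'a \<Rightarrow> real ^ 'd::finite"
  assumes X: "distributed M lborel X (\<lambda>x. ennreal (multi_normal_density 0 (mat 1) x))"
    and g: "0 \<le> g"
  shows "expectation (\<lambda>\<omega>. cos (X \<omega> \<bullet> h) * exp (- (g * (norm (X \<omega>))\<^sup>2) / 2)) =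
    exp (- (norm h)\<^sup>2 / (2 * (1 + g))) / (1 + g) powr (real CARD('d) / 2)"
proof -
  have c: "0 < 1 + g" using g by simp
  have dens: "multi_normal_density 0 (mat 1) x = exp (- (norm x)\<^sup>2 / 2) / sqrt (2 * pi) ^ CARD('d)"
    for x :: "real ^ 'd"
    unfolding multi_normal_density_def matrix_inv_mat_1 det_I mult_1_right real_sqrt_power
    by (simp add: power2_norm_eq_inner)
  have "expectation (\<lambda>\<omega>. cos (X \<omega> \<bullet> h) * exp (- (g * (norm (X \<omega>))\<^sup>2) / 2)) =
      (LINT x|lborel. multi_normal_density 0 (mat 1) x * (cos (x \<bullet> h) * exp (- (g * (norm x)\<^sup>2) / 2)))"
    by (rule distributed_integral[OF X, symmetric]) (auto simp: dens)
  also have "\<dots> = (LINT x|lborel. Re (iexp (h \<bullet> x) * exp (- ((1 + g) * (norm x)\<^sup>2) / 2)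
      / sqrt (2 * pi) ^ CARD('d)))"
  proof (intro Bochner_Integration.integral_cong refl)
    fix x :: "real ^ 'd"
    have "exp (- ((1 + g) * (norm x)\<^sup>2) / 2) = exp (- (norm x)\<^sup>2 / 2) * exp (- (g * (norm x)\<^sup>2) / 2)"
      by (simp add: exp_add[symmetric] field_simps)
    then show "multi_normal_density 0 (mat 1) x * (cos (x \<bullet> h) * exp (- (g * (norm x)\<^sup>2) / 2)) =
        Re (iexp (h \<bullet> x) * exp (- ((1 + g) * (norm x)\<^sup>2) / 2) / sqrt (2 * pi) ^ CARD('d))"
      by (simp add: dens Re_exp inner_commute flip: of_real_power)
  qed
  also have "\<dots> = Re (CLINT x|lborel. iexp (h \<bullet> x) * exp (- ((1 + g) * (norm x)\<^sup>2) / 2)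
      / sqrt (2 * pi) ^ CARD('d))"
    by (rule integral_Re[OF gaussian_integral_iexp(1)[OF c]])
  also have "\<dots> = exp (- (norm h)\<^sup>2 / (2 * (1 + g))) / (1 + g) powr (real CARD('d) / 2)"
    by (subst gaussian_integral_iexp(2)[OF c]) (simp flip: of_real_divide)
  finally show ?thesis .
qed


section \<open>Laplace transforms are bounded and completely monotone\<close>

text \<open>A Taylor estimate that is uniform in \<open>r\<close> up to the factor \<open>r\<^sup>2 * exp (- r * d)\<close>. It is obtained
  from the mean value theorem, applied to \<open>z \<mapsto> exp (- r * z) + z * (r * exp (- r * x))\<close>, whose
  derivative vanishes at \<open>x\<close> and is small nearby.\<close>
lemma exp_second_order_bound:
  fixes r x y d :: real
  assumes r: "0 \<le> r" and d: "d \<le> x" "d \<le> y"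
  shows "\<bar>exp (- r * y) - exp (- r * x) + (y - x) * (r * exp (- r * x))\<bar>
    \<le> (y - x)\<^sup>2 * (r\<^sup>2 * exp (- r * d))"
proof -
  have step: "\<bar>exp (- r * u) - exp (- r * v)\<bar> \<le> \<bar>u - v\<bar> * (r * exp (- r * d))"
    if "d \<le> u" "d \<le> v" for u v
  proof -
    have "norm (exp (- r * u) - exp (- r * v)) \<le> r * exp (- r * d) * norm (u - v)"
    proof (rule field_differentiable_bound[where S = "{d..}"])
      show "((\<lambda>z. exp (- r * z)) has_field_derivative - (r * exp (- r * z))) (at z within {d..})" for z
        by (auto intro!: derivative_eq_intros)
      show "norm (- (r * exp (- r * z))) \<le> r * exp (- r * d)" if "z \<in> {d..}" for z
        using that r by (auto simp: abs_mult intro!: mult_left_mono)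
    qed (use that in auto)
    then show ?thesis by (simp add: mult.commute)
  qed
  define F where "F z = exp (- r * z) + z * (r * exp (- r * x))" for z
  have "norm (F y - F x) \<le> \<bar>y - x\<bar> * r * (r * exp (- r * d)) * norm (y - x)"
  proof (rule field_differentiable_bound[where S = "closed_segment x y"])
    show "(F has_field_derivative (- r * (exp (- r * z) - exp (- r * x)))) (at z within closed_segment x y)"
      for z
      unfolding F_def by (auto intro!: derivative_eq_intros simp: algebra_simps)
    fix z assume z: "z \<in> closed_segment x y"
    then have "\<bar>z - x\<bar> \<le> \<bar>y - x\<bar>" "d \<le> z"
      using d by (auto simp: closed_segment_eq_real_ivl split: if_splits)
    then have "\<bar>exp (- r * z) - exp (- r * x)\<bar> \<le> \<bar>y - x\<bar> * (r * exp (- r * d))"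
      using step[of z x] d r mult_right_mono[of "\<bar>z - x\<bar>" "\<bar>y - x\<bar>" "r * exp (- r * d)"] by simp
    then have "r * \<bar>exp (- r * z) - exp (- r * x)\<bar> \<le> r * (\<bar>y - x\<bar> * (r * exp (- r * d)))"
      using r by (intro mult_left_mono)
    then show "norm (- r * (exp (- r * z) - exp (- r * x))) \<le> \<bar>y - x\<bar> * r * (r * exp (- r * d))"
      using r by (simp add: abs_mult mult_ac)
  qed auto
  moreover have "\<bar>y - x\<bar> * r * (r * exp (- r * d)) * \<bar>y - x\<bar> = (y - x)\<^sup>2 * (r\<^sup>2 * exp (- r * d))"
    by (subst power2_abs[of "y - x", symmetric])
       (simp add: power2_eq_square mult_ac del: power2_abs abs_mult_self_eq)
  moreover have "F y - F x = exp (- r * y) - exp (- r * x) + (y - x) * (r * exp (- r * x))"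
    by (simp add: F_def algebra_simps)
  ultimately show ?thesis by (simp only: real_norm_def)
qed

text \<open>The exponential series dominates each of its terms. This makes all moments weighted by
  \<open>exp (- r * d)\<close> finite, although the moments of \<open>R\<close> itself may be infinite.\<close>
lemma power_times_exp_bounded:
  fixes d :: real
  assumes "0 < d"
  shows "\<exists>B. \<forall>r\<ge>0. r ^ n * exp (- r * d) \<le> B"
proof (intro exI allI impI)
  fix r :: real assume r: "0 \<le> r"
  have "(r * d) ^ n / fact n \<le> exp (r * d)"
  proof -
    have "(\<Sum>k\<in>{n}. (r * d) ^ k /\<^sub>R fact k) \<le> (\<Sum>k. (r * d) ^ k /\<^sub>R fact k)"
      using r assms by (intro sum_le_suminf summable_exp_generic) auto
    then show ?thesis unfolding exp_def by (simp add: divide_inverse mult.commute)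
  qed
  then have "(r * d) ^ n * exp (- r * d) \<le> fact n"
    by (simp add: exp_minus divide_simps mult.commute)
  then show "r ^ n * exp (- r * d) \<le> fact n / d ^ n"
    using assms by (simp add: pos_le_divide_eq power_mult_distrib mult_ac)
qed

text \<open>Differentiation under the expectation. Near \<open>x > 0\<close> all arguments are at least \<open>d = x / 2\<close>, so the
  second-order remainder of the integrand is at most \<open>B * (y - x)\<^sup>2\<close> with \<open>B\<close> a bound of
  \<open>r ^ (n + 2) * exp (- r * d)\<close>. The same bound holds for the remainder of the transform.\<close>
lemma (in prob_space) laplace_transform_derivative:
  fixes R :: "'a \<Rightarrow> real"
  assumes [measurable]: "R \<in> borel_measurable M" and nonneg: "AE \<omega> in M. 0 \<le> R \<omega>" and x: "0 < x"
  shows "((\<lambda>x. expectation (\<lambda>\<omega>. (- R \<omega>) ^ n * exp (- R \<omega> * x))) has_field_derivative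
      expectation (\<lambda>\<omega>. (- R \<omega>) ^ Suc n * exp (- R \<omega> * x))) (at x)"
proof -
  define L where "L n x = expectation (\<lambda>\<omega>. (- R \<omega>) ^ n * exp (- R \<omega> * x))" for n x
  have int: "integrable M (\<lambda>\<omega>. (- R \<omega>) ^ n * exp (- R \<omega> * y))" if y: "0 < y" for n y
  proof -
    obtain B where B: "\<And>r. 0 \<le> r \<Longrightarrow> r ^ n * exp (- r * y) \<le> B"
      using power_times_exp_bounded[OF y, of n] by auto
    show ?thesis
    proof (rule integrable_const_bound[where B=B])
      show "AE \<omega> in M. norm ((- R \<omega>) ^ n * exp (- R \<omega> * y)) \<le> B"
        using nonneg by eventually_elim (use B in \<open>auto simp: abs_mult power_abs\<close>)
    qed simp
  qed
  define d where "d = x / 2"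
  have d: "0 < d" "d < x" using x by (auto simp: d_def)
  obtain B where B: "\<And>r. 0 \<le> r \<Longrightarrow> r ^ (n + 2) * exp (- r * d) \<le> B"
    using power_times_exp_bounded[OF d(1), of "n + 2"] by auto
  have quad: "\<bar>L n y - L n x - (y - x) * L (Suc n) x\<bar> \<le> B * (y - x)\<^sup>2" if y: "d \<le> y" for y
  proof -
    let ?e = "\<lambda>\<omega>. (- R \<omega>) ^ n * exp (- R \<omega> * y) - (- R \<omega>) ^ n * exp (- R \<omega> * x)
        - (y - x) * ((- R \<omega>) ^ Suc n * exp (- R \<omega> * x))"
    have factor: "P * a - P * b - c * (- r * P * b) = P * (a - b + c * (r * b))"
      for P a b c r :: real
      by (simp add: algebra_simps)
    have e_int: "integrable M ?e"
      using int[of y n] int[of x n] int[of x "Suc n"] x y d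
      by (intro Bochner_Integration.integrable_diff integrable_mult_right) auto
    have eq: "L n y - L n x - (y - x) * L (Suc n) x = expectation ?e"
      unfolding L_def using int[of y n] int[of x n] int[of x "Suc n"] x y d by simp
    have "\<bar>expectation ?e\<bar> \<le> expectation (\<lambda>\<omega>. \<bar>?e \<omega>\<bar>)"
      by (rule integral_abs_bound)
    also have "\<dots> \<le> expectation (\<lambda>\<omega>. B * (y - x)\<^sup>2)"
    proof (rule integral_mono_AE)
      show "AE \<omega> in M. \<bar>?e \<omega>\<bar> \<le> B * (y - x)\<^sup>2"
        using nonneg
      proof eventually_elim
        fix \<omega> assume r: "0 \<le> R \<omega>"
        have "?e \<omega> = (- R \<omega>) ^ n *
            (exp (- R \<omega> * y) - exp (- R \<omega> * x) + (y - x) * (R \<omega> * exp (- R \<omega> * x)))"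
          unfolding power_Suc by (rule factor)
        then have "\<bar>?e \<omega>\<bar> = R \<omega> ^ n *
            \<bar>exp (- R \<omega> * y) - exp (- R \<omega> * x) + (y - x) * (R \<omega> * exp (- R \<omega> * x))\<bar>"
          using r by (simp add: abs_mult power_abs)
        also have "\<dots> \<le> R \<omega> ^ n * ((y - x)\<^sup>2 * ((R \<omega>)\<^sup>2 * exp (- R \<omega> * d)))"
          using r d y by (intro mult_left_mono exp_second_order_bound) auto
        also have "\<dots> = (R \<omega> ^ (n + 2) * exp (- R \<omega> * d)) * (y - x)\<^sup>2"
          by (simp add: power_add power2_eq_square mult_ac)
        also have "\<dots> \<le> B * (y - x)\<^sup>2"
          using B[OF r] by (rule mult_right_mono) simp
        finally show "\<bar>?e \<omega>\<bar> \<le> B * (y - x)\<^sup>2" .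
      qed
    qed (use e_int in auto)
    finally show ?thesis unfolding eq by (simp only: lebesgue_integral_const prob_space scaleR_one)
  qed
  have "(L n has_field_derivative L (Suc n) x) (at x)"
    unfolding has_field_derivative_iff
  proof (subst LIM_zero_iff[symmetric], rule Lim_null_comparison)
    have "((\<lambda>y. B * \<bar>y - x\<bar>) \<longlongrightarrow> B * \<bar>x - x\<bar>) (at x)"
      by (intro tendsto_intros)
    then show "((\<lambda>y. B * \<bar>y - x\<bar>) \<longlongrightarrow> 0) (at x)" by simp
    have "eventually (\<lambda>y. y \<in> {d<..}) (at x)"
      using d by (intro eventually_at_in_open') auto
    moreover have "eventually (\<lambda>y. y \<noteq> x) (at x)"
      by (simp add: eventually_at_filter)
    ultimately show "\<forall>\<^sub>F y in at x. norm ((L n y - L n x) / (y - x) - L (Suc n) x) \<le> B * \<bar>y - x\<bar>"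
    proof eventually_elim
      fix y assume y: "y \<in> {d<..}" "y \<noteq> x"
      have "norm ((L n y - L n x) / (y - x) - L (Suc n) x) =
          \<bar>L n y - L n x - (y - x) * L (Suc n) x\<bar> / \<bar>y - x\<bar>"
        using y by (simp add: field_simps flip: abs_divide)
      also have "\<dots> \<le> B * (y - x)\<^sup>2 / \<bar>y - x\<bar>"
        using y by (intro divide_right_mono quad) auto
      also have "\<dots> = B * \<bar>y - x\<bar>"
        using y by (subst power2_abs[of "y - x", symmetric])
          (simp add: power2_eq_square del: power2_abs abs_mult_self_eq)
      finally show "norm ((L n y - L n x) / (y - x) - L (Suc n) x) \<le> B * \<bar>y - x\<bar>" .
    qed
  qed
  then show ?thesis by (simp add: L_def[abs_def])
qed

text \<open>The easy direction of Bernstein's theorem: each derivative contributes a factor \<open>- R\<close>, hence the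
  alternating signs. Boundedness by \<open>1\<close> and, by dominated convergence, continuity up to \<open>0\<close> follow
  from \<open>R \<ge> 0\<close>.\<close>
lemma (in prob_space) laplace_transform_bounded_completely_monotone:
  fixes R :: "'a \<Rightarrow> real"
  assumes [measurable]: "R \<in> borel_measurable M" and nonneg: "AE \<omega> in M. 0 \<le> R \<omega>"
  shows "bounded_completely_monotone (\<lambda>x. expectation (\<lambda>\<omega>. exp (- R \<omega> * x)))"
proof -
  define f where "f x = expectation (\<lambda>\<omega>. exp (- R \<omega> * x))" for x
  define L where "L n x = expectation (\<lambda>\<omega>. (- R \<omega>) ^ n * exp (- R \<omega> * x))" for n x
  have L_deriv: "(L n has_field_derivative L (Suc n) x) (at x)" if "0 < x" for n x
    unfolding L_def by (rule laplace_transform_derivative) (use that nonneg in auto)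
  have derivs: "(deriv ^^ n) f x = L n x" if "0 < x" for n x
    using that
  proof (induction n arbitrary: x)
    case 0
    then show ?case by (simp add: f_def L_def)
  next
    case (Suc n)
    have "((deriv ^^ n) f has_field_derivative L (Suc n) x) (at x)"
      by (rule has_field_derivative_transform_within_open[OF L_deriv, where S = "{0<..}"])
         (use Suc in auto)
    then show ?case by (simp add: DERIV_imp_deriv)
  qed
  have le_1: "AE \<omega> in M. norm (exp (- R \<omega> * x)) \<le> 1" if "0 \<le> x" for x
    using nonneg by eventually_elim (use that in auto)
  have f_nonneg: "0 \<le> f x" for x
    unfolding f_def by (rule integral_nonneg_AE) simp
  have "f x \<le> 1" if "0 \<le> x" for x
  proof -
    have "f x \<le> expectation (\<lambda>_. 1)"
      unfolding f_def using le_1[OF that] integrable_const_bound[OF le_1[OF that]]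
      by (intro integral_mono_AE) auto
    then show ?thesis by (simp add: prob_space)
  qed
  then have bdd: "bounded (f ` {0<..})"
    using f_nonneg by (auto simp: bounded_iff intro!: exI[of _ 1])
  have cont: "continuous_on {0..} f"
    unfolding continuous_on_sequentially comp_def
  proof (intro allI ballI impI, elim conjE)
    fix X :: "nat \<Rightarrow> real" and a assume X: "\<forall>n. X n \<in> {0..}" and lim: "X \<longlonglongrightarrow> a"
    show "(\<lambda>n. f (X n)) \<longlonglongrightarrow> f a"
      unfolding f_def
    proof (rule integral_dominated_convergence[where w = "\<lambda>_. 1"])
      show "AE \<omega> in M. (\<lambda>n. exp (- R \<omega> * X n)) \<longlonglongrightarrow> exp (- R \<omega> * a)"
        using lim by (intro AE_I2 tendsto_intros)
      show "AE \<omega> in M. norm (exp (- R \<omega> * X n)) \<le> 1" for n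
        using X by (intro le_1) auto
    qed auto
  qed
  have "(deriv ^^ n) f field_differentiable (at x)" if "0 < x" for n x
    using has_field_derivative_transform_within_open[OF L_deriv[OF that, of n], of "{0<..}" "(deriv ^^ n) f"]
      that derivs unfolding field_differentiable_def by auto
  moreover have "0 \<le> (-1) ^ n * (deriv ^^ n) f x" if "0 < x" for n x
  proof -
    have "(-1) ^ n * L n x = expectation (\<lambda>\<omega>. R \<omega> ^ n * exp (- R \<omega> * x))"
      unfolding L_def
      by (subst integral_mult_right_zero[symmetric]) (simp add: power_mult_distrib[symmetric] mult.assoc[symmetric])
    also have "0 \<le> \<dots>"
      by (rule integral_nonneg_AE) (use nonneg in \<open>eventually_elim, simp\<close>)
    finally show ?thesis by (simp add: derivs that)
  qed
  ultimately show ?thesis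
    using bdd cont f_nonneg unfolding f_def[symmetric]
    by (simp add: bounded_completely_monotone_def completely_monotone_def)
qed


section \<open>Random amplitude and random phase\<close>

text \<open>For \<open>a \<ge> 0\<close> the condition \<open>- ln U \<le> a\<close> cuts out the interval from \<open>exp (- a)\<close> to \<open>1\<close>.\<close>
lemma (in prob_space) neg_ln_uniform_exponential:
  assumes U: "uniform_rv M U {0<..<1}"
  shows "distributed M lborel (\<lambda>\<omega>. - ln (U \<omega>)) (exponential_density 1)"
proof (rule exponential_distributedI)
  have [measurable]: "U \<in> borel_measurable M" and law: "distr M borel U = uniform_measure lborel {0<..<1}"
    using U by (auto simp: uniform_rv_def)
  show "(\<lambda>\<omega>. - ln (U \<omega>)) \<in> borel_measurable M" by measurable
  fix a :: real assume a: "0 \<le> a"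
  have "emeasure M {\<omega> \<in> space M. - ln (U \<omega>) \<le> a} = emeasure (distr M borel U) {u. - ln u \<le> a}"
    by (subst emeasure_distr) (auto intro!: arg_cong[where f = "emeasure M"])
  also have "\<dots> = emeasure lborel ({0<..<1} \<inter> {u. - ln u \<le> (a :: real)})"
    unfolding law by (subst emeasure_uniform_measure) (auto simp: divide_ennreal_def)
  also have "{0<..<1} \<inter> {u. - ln u \<le> (a :: real)} = {exp (- a)..<1}"
  proof -
    have "- ln u \<le> a \<longleftrightarrow> exp (- a) \<le> u" if "0 < u" for u
      using that ln_ge_iff[of u "- a"] by linarith
    moreover have "0 < u" if "exp (- a) \<le> u" for u
      using that exp_gt_zero[of "- a"] by linarith
    ultimately show ?thesis by auto
  qed
  also have "emeasure lborel {exp (- a)..<1} = ennreal (1 - exp (- a))"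
    using a by (simp add: emeasure_lborel_Ico)
  finally show "emeasure M {\<omega> \<in> space M. - ln (U \<omega>) \<le> a} = 1 - ennreal (exp (- a * 1))"
    by (simp add: ennreal_minus flip: ennreal_1)
qed simp

text \<open>The square is \<open>2 * (- ln U)\<close>, twice a standard exponential variable, but only almost surely:
  outside \<open>(0, 1)\<close> the radicand may be negative, and there \<open>sqrt\<close> is odd by convention.\<close>
lemma (in prob_space) box_muller_amplitude:
  assumes U: "uniform_rv M U {0<..<1}"
  shows "integrable M (\<lambda>\<omega>. (sqrt (- 2 * ln (U \<omega>)))\<^sup>2)" "integrable M (\<lambda>\<omega>. sqrt (- 2 * ln (U \<omega>)))"
    and "expectation (\<lambda>\<omega>. (sqrt (- 2 * ln (U \<omega>)))\<^sup>2) = 2"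
proof -
  have [measurable]: "U \<in> borel_measurable M" and law: "distr M borel U = uniform_measure lborel {0<..<1}"
    using U by (auto simp: uniform_rv_def)
  note D = neg_ln_uniform_exponential[OF U]
  have "AE u in uniform_measure lborel {0<..<1::real}. u \<in> {0<..<1}"
    by (rule AE_uniform_measureI) auto
  then have "AE \<omega> in M. U \<omega> \<in> {0<..<1}"
    unfolding law[symmetric] by (subst (asm) AE_distr_iff) auto
  then have sq: "AE \<omega> in M. (sqrt (- 2 * ln (U \<omega>)))\<^sup>2 = 2 * (- ln (U \<omega>))"
    by eventually_elim (auto intro!: real_sqrt_pow2)
  have int: "integrable M (\<lambda>\<omega>. - ln (U \<omega>))"
    using erlang_ith_moment_integrable[OF _ D, of 1] by simp
  show int2: "integrable M (\<lambda>\<omega>. (sqrt (- 2 * ln (U \<omega>)))\<^sup>2)"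
    by (subst integrable_cong_AE[OF _ _ sq]) (use int in auto)
  have "expectation (\<lambda>\<omega>. (sqrt (- 2 * ln (U \<omega>)))\<^sup>2) = expectation (\<lambda>\<omega>. 2 * (- ln (U \<omega>)))"
    by (rule integral_cong_AE) (use sq in auto)
  also have "\<dots> = 2"
    using exponential_distributed_expectation[OF _ D] by (subst integral_mult_right_zero) simp
  finally show "expectation (\<lambda>\<omega>. (sqrt (- 2 * ln (U \<omega>)))\<^sup>2) = 2" .
  show "integrable M (\<lambda>\<omega>. sqrt (- 2 * ln (U \<omega>)))"
    by (rule square_integrable_imp_integrable[OF _ int2]) measurable
qed

text \<open>The interval of length \<open>2 * pi\<close> contains exactly \<open>n\<close> full periods.\<close>
lemma (in prob_space) expectation_cos_uniform_phase:
  assumes \<Phi>: "uniform_rv M \<Phi> {0<..<2 * pi}" and n: "0 < n"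
  shows "expectation (\<lambda>\<omega>. cos (a + real n * \<Phi> \<omega>)) = 0"
proof -
  have [measurable]: "\<Phi> \<in> borel_measurable M"
    and law: "distr M borel \<Phi> = uniform_measure lborel {0<..<2 * pi}"
    using \<Phi> by (auto simp: uniform_rv_def)
  have "expectation (\<lambda>\<omega>. cos (a + real n * \<Phi> \<omega>)) =
      (LINT x|uniform_measure lborel {0<..<2 * pi}. cos (a + real n * x))"
    unfolding law[symmetric] by (rule integral_distr[symmetric]) auto
  also have "uniform_measure lborel {0<..<2 * pi} =
      density lborel (\<lambda>x. ennreal (indicator {0<..<2 * pi} x / (2 * pi)))"
    unfolding uniform_measure_def
    by (rule density_cong) (auto simp: divide_ennreal[symmetric] split: split_indicator)
  also have "(LINT x|\<dots>. cos (a + real n * x)) =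
      (LINT x|lborel. (indicator {0<..<2 * pi} x / (2 * pi)) *\<^sub>R cos (a + real n * x))"
    by (rule integral_density) auto
  also have "\<dots> = (LINT x|lborel. (cos (a + real n * x) / (2 * pi)) * indicator {0..2 * pi} x)"
  proof (rule integral_cong_AE)
    show "AE x in lborel. (indicator {0<..<2 * pi} x / (2 * pi)) *\<^sub>R cos (a + real n * x) =
        (cos (a + real n * x) / (2 * pi)) * indicator {0..2 * pi} x"
      using AE_lborel_singleton[of "0::real"] AE_lborel_singleton[of "2 * pi"]
      by eventually_elim (auto split: split_indicator)
  qed auto
  also have "\<dots> = sin (a + real n * (2 * pi)) / (real n * (2 * pi)) - sin (a + real n * 0) / (real n * (2 * pi))"
    by (rule integral_FTC_Icc_real) (use n in \<open>auto intro!: derivative_eq_intros continuous_intros\<close>)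
  also have "sin (a + real n * (2 * pi)) = sin a"
    using sin_int_2pin[of "int n"] cos_int_2pin[of "int n"] by (simp add: sin_add mult_ac)
  finally show ?thesis by simp
qed

text \<open>By the product-to-sum formula the phase survives only in \<open>cos (A + B + 2 * \<Phi>)\<close>, whose mean
  vanishes.\<close>
lemma (in prob_space) uniform_phase_averages:
  assumes \<Phi>: "uniform_rv M \<Phi> {0<..<2 * pi}"
    and indep: "indep_rv M borel \<Phi> (borel \<Otimes>\<^sub>M borel) (\<lambda>\<omega>. (A \<omega>, B \<omega>))"
  shows "expectation (\<lambda>\<omega>. cos (A \<omega> + \<Phi> \<omega>)) = 0"
    and "expectation (\<lambda>\<omega>. cos (A \<omega> + \<Phi> \<omega>) * cos (B \<omega> + \<Phi> \<omega>)) = expectation (\<lambda>\<omega>. cos (A \<omega> - B \<omega>)) / 2"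
proof -
  have [measurable]: "\<Phi> \<in> borel_measurable M" using \<Phi> by (simp add: uniform_rv_def)
  have "expectation (\<lambda>\<omega>. cos (A \<omega> + \<Phi> \<omega>)) = expectation (\<lambda>\<omega>'. expectation (\<lambda>\<omega>. cos (A \<omega>' + \<Phi> \<omega>)))"
    using indep_rv_expectation[OF indep, of "\<lambda>p (a, b). cos (a + p)" 1] by (simp add: split_beta')
  then show "expectation (\<lambda>\<omega>. cos (A \<omega> + \<Phi> \<omega>)) = 0"
    using expectation_cos_uniform_phase[OF \<Phi>, of 1] by simp
  have int: "integrable M (\<lambda>\<omega>. cos (c + k * \<Phi> \<omega>))" for c k :: real
    by (rule integrable_const_bound[where B = 1]) auto
  have inner: "expectation (\<lambda>\<omega>. cos (a + \<Phi> \<omega>) * cos (b + \<Phi> \<omega>)) = cos (a - b) / 2" for a b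
  proof -
    have "cos (a + \<Phi> \<omega>) * cos (b + \<Phi> \<omega>) = cos (a - b) / 2 + cos ((a + b) + 2 * \<Phi> \<omega>) / 2" for \<omega>
      by (simp add: cos_times_cos add_divide_distrib algebra_simps)
    then have "expectation (\<lambda>\<omega>. cos (a + \<Phi> \<omega>) * cos (b + \<Phi> \<omega>)) =
        cos (a - b) / 2 + expectation (\<lambda>\<omega>. cos ((a + b) + 2 * \<Phi> \<omega>)) / 2"
      using int[of "a + b" 2] by (simp add: prob_space)
    then show ?thesis
      using expectation_cos_uniform_phase[OF \<Phi>, of 2 "a + b"] by simp
  qed
  have "expectation (\<lambda>\<omega>. cos (A \<omega> + \<Phi> \<omega>) * cos (B \<omega> + \<Phi> \<omega>)) =
      expectation (\<lambda>\<omega>'. expectation (\<lambda>\<omega>. cos (A \<omega>' + \<Phi> \<omega>) * cos (B \<omega>' + \<Phi> \<omega>)))"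
    using indep_rv_expectation[OF indep, of "\<lambda>p (a, b). cos (a + p) * cos (b + p)" 1]
    by (simp add: split_beta' abs_mult mult_le_one)
  then show "expectation (\<lambda>\<omega>. cos (A \<omega> + \<Phi> \<omega>) * cos (B \<omega> + \<Phi> \<omega>)) =
      expectation (\<lambda>\<omega>. cos (A \<omega> - B \<omega>)) / 2"
    by (simp add: inner)
qed

text \<open>The mean square \<open>2\<close> of the amplitude cancels the factor \<open>1 / 2\<close> that averaging over the phase
  leaves. Both variables are centred because of the phase, so the covariance is the mean of the
  product.\<close>
lemma (in prob_space) random_wave_covariance:
  assumes U: "uniform_rv M U {0<..<1}" and \<Phi>: "uniform_rv M \<Phi> {0<..<2 * pi}"
    and indep_U: "indep_rv M borel U (borel \<Otimes>\<^sub>M (borel \<Otimes>\<^sub>M borel)) (\<lambda>\<omega>. (\<Phi> \<omega>, (A \<omega>, B \<omega>)))"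
    and indep_\<Phi>: "indep_rv M borel \<Phi> (borel \<Otimes>\<^sub>M borel) (\<lambda>\<omega>. (A \<omega>, B \<omega>))"
  defines "X \<equiv> \<lambda>\<omega>. sqrt (- 2 * ln (U \<omega>)) * cos (A \<omega> + \<Phi> \<omega>)"
    and "Y \<equiv> \<lambda>\<omega>. sqrt (- 2 * ln (U \<omega>)) * cos (B \<omega> + \<Phi> \<omega>)"
  shows "cov_exists M X Y" and "cov M X Y = expectation (\<lambda>\<omega>. cos (A \<omega> - B \<omega>))"
proof -
  have [measurable]: "U \<in> borel_measurable M" "\<Phi> \<in> borel_measurable M"
    using U \<Phi> by (auto simp: uniform_rv_def)
  have AB[measurable]: "(\<lambda>\<omega>. (A \<omega>, B \<omega>)) \<in> measurable M (borel \<Otimes>\<^sub>M borel)"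
    using indep_\<Phi> by (simp add: indep_rv_def)
  have [measurable]: "A \<in> borel_measurable M" "B \<in> borel_measurable M"
    using measurable_compose[OF AB measurable_fst] measurable_compose[OF AB measurable_snd] by simp_all
  have prod: "integrable M (\<lambda>\<omega>. g (U \<omega>) * f (\<Phi> \<omega>) (A \<omega>) (B \<omega>)) \<and>
      expectation (\<lambda>\<omega>. g (U \<omega>) * f (\<Phi> \<omega>) (A \<omega>) (B \<omega>)) =
      expectation (\<lambda>\<omega>. g (U \<omega>)) * expectation (\<lambda>\<omega>. f (\<Phi> \<omega>) (A \<omega>) (B \<omega>))"
    if g[measurable]: "g \<in> borel_measurable borel" and int: "integrable M (\<lambda>\<omega>. g (U \<omega>))"
      and f[measurable]: "(\<lambda>(p, a, b). f p a b) \<in> borel_measurable (borel \<Otimes>\<^sub>M (borel \<Otimes>\<^sub>M borel))"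
      and bounded: "\<And>p a b. \<bar>f p a b\<bar> \<le> 1"
    for g :: "real \<Rightarrow> real" and f :: "real \<Rightarrow> real \<Rightarrow> real \<Rightarrow> real"
  proof -
    have "indep_rv M borel U borel (\<lambda>\<omega>. f (\<Phi> \<omega>) (A \<omega>) (B \<omega>))"
      using indep_rv_compose_right[OF indep_U f] by simp
    then have "indep_rv M borel (\<lambda>\<omega>. g (U \<omega>)) borel (\<lambda>\<omega>. f (\<Phi> \<omega>) (A \<omega>) (B \<omega>))"
      using indep_rv_compose_right[OF indep_rv_sym g] indep_rv_sym by blast
    moreover have "integrable M (\<lambda>\<omega>. f (\<Phi> \<omega>) (A \<omega>) (B \<omega>))"
    proof (rule integrable_const_bound[where B = 1])
      show "(\<lambda>\<omega>. f (\<Phi> \<omega>) (A \<omega>) (B \<omega>)) \<in> borel_measurable M"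
        using measurable_compose[of "\<lambda>\<omega>. (\<Phi> \<omega>, A \<omega>, B \<omega>)" M _ "\<lambda>(p, a, b). f p a b"] f by simp
    qed (use bounded in auto)
    ultimately show ?thesis using indep_rv_product int by blast
  qed
  note amp = box_muller_amplitude[OF U]
  have X: "integrable M X" "expectation X = 0"
    using prod[of "\<lambda>u. sqrt (- 2 * ln u)" "\<lambda>p a b. cos (a + p)"] amp uniform_phase_averages(1)[OF \<Phi> indep_\<Phi>]
    by (auto simp: X_def)
  have "indep_rv M borel \<Phi> (borel \<Otimes>\<^sub>M borel) (\<lambda>\<omega>. (B \<omega>, A \<omega>))"
    using indep_rv_compose_right[OF indep_\<Phi>, of "\<lambda>(a, b). (b, a)"] by simp
  then have Y: "integrable M Y" "expectation Y = 0"
    using prod[of "\<lambda>u. sqrt (- 2 * ln u)" "\<lambda>p a b. cos (b + p)"] amp uniform_phase_averages(1)[OF \<Phi>]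
    by (auto simp: Y_def)
  have XY_eq: "X \<omega> * Y \<omega> = (sqrt (- 2 * ln (U \<omega>)))\<^sup>2 * (cos (A \<omega> + \<Phi> \<omega>) * cos (B \<omega> + \<Phi> \<omega>))" for \<omega>
    by (simp only: X_def Y_def power2_eq_square mult_ac)
  have XY: "integrable M (\<lambda>\<omega>. X \<omega> * Y \<omega>) \<and>
      expectation (\<lambda>\<omega>. X \<omega> * Y \<omega>) = expectation (\<lambda>\<omega>. cos (A \<omega> - B \<omega>))"
    unfolding XY_eq
    using prod[of "\<lambda>u. (sqrt (- 2 * ln u))\<^sup>2" "\<lambda>p a b. cos (a + p) * cos (b + p)"] amp
      uniform_phase_averages(2)[OF \<Phi> indep_\<Phi>]
    by (simp add: abs_mult mult_le_one)
  show "cov_exists M X Y" using X Y XY by (simp add: cov_exists_def)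
  show "cov M X Y = expectation (\<lambda>\<omega>. cos (A \<omega> - B \<omega>))"
    using X Y XY by (simp add: cov_def)
qed


section \<open>Averaging over the spectral vector\<close>

text \<open>The mean over \<open>D\<close>, with \<open>R\<close> and \<open>\<Omega>\<close> fixed, produces the damping \<open>exp (- g * (norm \<Omega>)\<^sup>2 / 2)\<close>;
  here the factor \<open>1 / sqrt 2\<close> in front of \<open>D\<close> makes \<open>g\<close> half of the variance. The mean over
  \<open>\<Omega>\<close>, with \<open>R\<close> fixed, is then a Gaussian Fourier transform at \<open>sqrt (2 * R) *\<^sub>R h\<close>, whose
  squared norm \<open>2 * R * (norm h)\<^sup>2\<close> is linear in \<open>R\<close>. This linearity makes the remaining mean over
  \<open>R\<close> a Laplace transform.\<close>
lemma (in prob_space) gaussian_mixture_spectral_average: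
  fixes \<Omega> :: "'a \<Rightarrow> real ^ 'd::finite"
  assumes R: "R \<in> borel_measurable M" "AE \<omega> in M. 0 \<le> R \<omega>"
    and \<Omega>: "distributed M lborel \<Omega> (\<lambda>x. ennreal (multi_normal_density 0 (mat 1) x))"
    and D: "normal_rv M D" "expectation D = 0"
    and indep_D: "indep_rv M borel D (borel \<Otimes>\<^sub>M borel) (\<lambda>\<omega>. (R \<omega>, \<Omega> \<omega>))"
    and indep_\<Omega>: "indep_rv M borel \<Omega> borel R"
  defines "g \<equiv> variance D / 2"
  shows "expectation (\<lambda>\<omega>. cos (sqrt (2 * R \<omega>) * (\<Omega> \<omega> \<bullet> h) + norm (\<Omega> \<omega>) / sqrt 2 * D \<omega>)) =
    1 / (1 + g) powr (real CARD('d) / 2) * expectation (\<lambda>\<omega>. exp (- R \<omega> * ((norm h)\<^sup>2 / (1 + g))))"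
proof -
  have g: "0 \<le> g" using variance_positive[of D] unfolding g_def by linarith
  have [measurable]: "R \<in> borel_measurable M" "\<Omega> \<in> borel_measurable M" "D \<in> borel_measurable M"
    using R distributed_measurable[OF \<Omega>] D by (auto simp: normal_rv_def)
  have "expectation (\<lambda>\<omega>. cos (sqrt (2 * R \<omega>) * (\<Omega> \<omega> \<bullet> h) + norm (\<Omega> \<omega>) / sqrt 2 * D \<omega>)) =
      expectation (\<lambda>\<omega>'. expectation (\<lambda>\<omega>. cos (sqrt (2 * R \<omega>') * (\<Omega> \<omega>' \<bullet> h) + norm (\<Omega> \<omega>') / sqrt 2 * D \<omega>)))"
    using indep_rv_expectation[OF indep_D,
        of "\<lambda>d (r, w). cos (sqrt (2 * r) * (w \<bullet> h) + norm w / sqrt 2 * d)" 1]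
    by (simp add: split_beta')
  also have "\<dots> = expectation (\<lambda>\<omega>. cos (\<Omega> \<omega> \<bullet> (sqrt (2 * R \<omega>) *\<^sub>R h)) * exp (- (g * (norm (\<Omega> \<omega>))\<^sup>2) / 2))"
    unfolding expectation_cos_centred_normal[OF D]
    by (simp add: g_def power_divide mult_ac)
  also have "\<dots> = expectation (\<lambda>\<omega>'. expectation (\<lambda>\<omega>. cos (\<Omega> \<omega> \<bullet> (sqrt (2 * R \<omega>') *\<^sub>R h)) *
      exp (- (g * (norm (\<Omega> \<omega>))\<^sup>2) / 2)))"
  proof (rule indep_rv_expectation[OF indep_\<Omega>,
        of "\<lambda>w r. cos (w \<bullet> (sqrt (2 * r) *\<^sub>R h)) * exp (- (g * (norm w)\<^sup>2) / 2)" 1])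
    show "\<bar>cos (w \<bullet> (sqrt (2 * r) *\<^sub>R h)) * exp (- (g * (norm w)\<^sup>2) / 2)\<bar> \<le> 1"
      for w :: "real ^ 'd" and r
      using g by (simp add: abs_mult mult_le_one)
  qed simp
  also have "\<dots> = expectation (\<lambda>\<omega>. exp (- (norm (sqrt (2 * R \<omega>) *\<^sub>R h))\<^sup>2 / (2 * (1 + g))) /
      (1 + g) powr (real CARD('d) / 2))"
    unfolding expectation_cos_exp_std_normal_vector[OF \<Omega> g] ..
  also have "\<dots> = expectation (\<lambda>\<omega>. 1 / (1 + g) powr (real CARD('d) / 2) * exp (- R \<omega> * ((norm h)\<^sup>2 / (1 + g))))"
  proof (rule integral_cong_AE)
    show "AE \<omega> in M. exp (- (norm (sqrt (2 * R \<omega>) *\<^sub>R h))\<^sup>2 / (2 * (1 + g))) / (1 + g) powr (real CARD('d) / 2) =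
        1 / (1 + g) powr (real CARD('d) / 2) * exp (- R \<omega> * ((norm h)\<^sup>2 / (1 + g)))"
      using R(2)
    proof eventually_elim
      fix \<omega> assume "0 \<le> R \<omega>"
      then have "(norm (sqrt (2 * R \<omega>) *\<^sub>R h))\<^sup>2 = 2 * (R \<omega> * (norm h)\<^sup>2)"
        by (simp add: power_mult_distrib)
      then have "(norm (sqrt (2 * R \<omega>) *\<^sub>R h))\<^sup>2 / (2 * (1 + g)) = R \<omega> * ((norm h)\<^sup>2 / (1 + g))"
        by (simp only: mult_divide_mult_cancel_left_if) simp
      then show "exp (- (norm (sqrt (2 * R \<omega>) *\<^sub>R h))\<^sup>2 / (2 * (1 + g))) / (1 + g) powr (real CARD('d) / 2) =
          1 / (1 + g) powr (real CARD('d) / 2) * exp (- R \<omega> * ((norm h)\<^sup>2 / (1 + g)))"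
        by (simp only: minus_divide_left[symmetric] mult_minus_left times_divide_eq_left mult_1)
    qed
  qed auto
  finally show ?thesis by simp
qed


section \<open>The Gneiting covariance of the random field\<close>

text \<open>The difference is a linear functional of the field on the set \<open>{s, t}\<close>. For \<open>s = t\<close> this set
  has one element, so the two coefficient vectors must be added up.\<close>
lemma gaussian_field_difference_normal:
  assumes "gaussian_field M W"
  shows "normal_rv M (\<lambda>\<omega>. W s \<omega> $ i - W t \<omega> $ j)"
proof (cases "s = t")
  case True
  have "normal_rv M (\<lambda>\<omega>. \<Sum>r\<in>{t}. (axis i 1 - axis j 1) \<bullet> W r \<omega>)"
    using assms unfolding gaussian_field_def by (elim conjE allE[of _ "{t}"] allE[of _ "\<lambda>_. axis i 1 - axis j 1"]) simp
  then show ?thesis by (simp add: True inner_diff_left inner_axis')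
next
  case False
  have "normal_rv M (\<lambda>\<omega>. \<Sum>r\<in>{s, t}. (if r = s then axis i 1 else - axis j 1) \<bullet> W r \<omega>)"
    using assms unfolding gaussian_field_def
    by (elim conjE allE[of _ "{s, t}"] allE[of _ "\<lambda>r. if r = s then axis i 1 else - axis j 1"]) simp
  then show ?thesis using False by (simp add: inner_axis')
qed

theorem theorem4p1:
  fixes M :: "'w measure"
    and \<mu> :: "real measure"
    and R U \<Phi> :: "'w \<Rightarrow> real"
    and \<Omega> :: "'w \<Rightarrow> real ^ 'd::finite"
    and W :: "real ^ 'l::finite \<Rightarrow> 'w \<Rightarrow> real ^ 'm::finite"
    and \<gamma> :: "'m \<Rightarrow> 'm \<Rightarrow> real ^ 'l \<Rightarrow> real"
    and Z :: "(real ^ 'd) \<times> (real ^ 'l) \<Rightarrow> 'w \<Rightarrow> real ^ 'm"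
  assumes "prob_space M"
    and "R \<in> borel_measurable M" and "AE \<omega> in M. 0 \<le> R \<omega>" and "distr M borel R = \<mu>"
    and "distributed M lborel \<Omega> (\<lambda>x. ennreal (multi_normal_density 0 (mat 1) x))"
    and "uniform_rv M U {0<..<1}"
    and "uniform_rv M \<Phi> {0<..<2 * pi}"
    and "gaussian_field M W" and "centred_field M W" and "has_pseudo_variogram M W \<gamma>"
    and "independent_families M
           [generated_events M borel R, generated_events M borel \<Omega>, generated_events M borel U,
            generated_events M borel \<Phi>, field_events M W]"
    and "\<And>x t \<omega> i. Z (x, t) \<omega> $ i =
           sqrt (- 2 * ln (U \<omega>)) *
           cos (sqrt (2 * R \<omega>) * (\<Omega> \<omega> \<bullet> x) + norm (\<Omega> \<omega>) / sqrt 2 * W t \<omega> $ i + \<Phi> \<omega>)"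
  shows "random_field M Z \<and>
         (\<exists>\<phi>. bounded_completely_monotone \<phi> \<and>
              has_covariance_function M Z (extended_gneiting \<phi> \<gamma>))"
proof -
  interpret prob_space M by fact
  note R = assms(2,3) and \<Omega> = assms(5) and U = assms(6) and \<Phi> = assms(7)
  note gaussian = assms(8) and centred = assms(9) and variogram = assms(10) and Z = assms(12)
  have [measurable]: "R \<in> borel_measurable M" "\<Omega> \<in> borel_measurable M" "U \<in> borel_measurable M"
      "\<Phi> \<in> borel_measurable M" "\<And>t. W t \<in> borel_measurable M"
    using assms(2) distributed_measurable[OF \<Omega>] U \<Phi> gaussian
    by (auto simp: uniform_rv_def gaussian_field_def random_field_def)
  have component: "(\<lambda>\<omega>. W t \<omega> $ i) \<in> borel_measurable N" if "W t \<in> borel_measurable N" for N t i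
    using that by (rule measurable_compose) simp
  have [measurable]: "(\<lambda>\<omega>. W t \<omega> $ i) \<in> borel_measurable M" for t i
    by (rule component) simp
  have field: "random_field M Z"
    unfolding random_field_def
  proof (intro allI)
    fix p :: "(real ^ 'd) \<times> (real ^ 'l)"
    obtain x t where p: "p = (x, t)" by (cases p)
    have "(\<lambda>\<omega>. Z (x, t) \<omega> $ i) \<in> borel_measurable M" for i
      unfolding Z by measurable
    then show "Z p \<in> borel_measurable M"
      unfolding p by (subst borel_measurable_euclidean_space)
        (auto simp: Basis_vec_def inner_axis)
  qed

  \<comment> \<open>The families are numbered as in the hypothesis: \<open>0, 1, 2, 3, 4\<close> for \<open>R, \<Omega>, U, \<Phi>, W\<close>.\<close>
  define F where "F k = [generated_events M borel R, generated_events M borel \<Omega>,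
      generated_events M borel U, generated_events M borel \<Phi>, field_events M W] ! k" for k
  \<comment> \<open>One source is separated from the others by checking for which of these sigma-algebras each
    compound expression is measurable.\<close>
  define G where "G K = sigma (space M) (\<Union>k\<in>K. F k)" for K
  have F_simps: "F 0 = generated_events M borel R" "F 1 = generated_events M borel \<Omega>"
    "F 2 = generated_events M borel U" "F 3 = generated_events M borel \<Phi>" "F 4 = field_events M W"
    by (simp_all add: F_def)
  have nat_5: "{..<5::nat} = {0, 1, 2, 3, 4}" by auto
  have indep: "indep_sets F {..<5}"
    using assms(11) by (simp add: independent_families_def F_def[abs_def] eval_nat_numeral)
  have F_stable: "Int_stable (F k)" if "k \<in> {..<5}" for k
    using that unfolding nat_5
    by (auto simp: F_simps[unfolded One_nat_def] field_events_def intro: generated_events_Int_stable)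
  have F_Pow: "F k \<subseteq> Pow (space M)" if "k \<in> {..<5}" for k
  proof -
    have "F k \<subseteq> events" using indep that by (auto simp only: indep_sets_def)
    then show ?thesis using sets.space_closed by (rule order_trans)
  qed
  have G_measurable: "X \<in> measurable (G K) N"
    if "F k = generated_events M N X" "k \<in> K" "K \<subseteq> {..<5}" "X \<in> space M \<rightarrow> space N"
    for X :: "'w \<Rightarrow> 'x" and N k K
    unfolding G_def by (rule measurable_sigma_generated_events) (use that F_Pow in blast)+
  have G_R: "R \<in> borel_measurable (G K)" if "0 \<in> K" "K \<subseteq> {..<5}" for K
    by (rule G_measurable[OF F_simps(1) that]) simp
  have G_\<Omega>: "\<Omega> \<in> borel_measurable (G K)" if "1 \<in> K" "K \<subseteq> {..<5}" for K
    by (rule G_measurable[OF F_simps(2) that]) simp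
  have G_U: "U \<in> borel_measurable (G K)" if "2 \<in> K" "K \<subseteq> {..<5}" for K
    by (rule G_measurable[OF F_simps(3) that]) simp
  have G_\<Phi>: "\<Phi> \<in> borel_measurable (G K)" if "3 \<in> K" "K \<subseteq> {..<5}" for K
    by (rule G_measurable[OF F_simps(4) that]) simp
  have G_W: "(\<lambda>\<omega>. W t \<omega> $ i) \<in> borel_measurable (G K)" if "4 \<in> K" "K \<subseteq> {..<5}" for K t i
  proof -
    have "(\<lambda>\<omega> t. W t \<omega>) \<in> measurable (G K) (PiM UNIV (\<lambda>_. borel))"
      by (rule G_measurable[OF F_simps(5)[unfolded field_events_def] that]) (simp add: space_PiM)
    then have "W t \<in> borel_measurable (G K)"
      by (rule measurable_compose[of _ _ _ "\<lambda>w. w t"]) simp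
    then show ?thesis by (rule component)
  qed
  note separate = indep_rv_if_indep_sets[OF indep F_stable, folded G_def]

  define \<phi> where "\<phi> = (\<lambda>x. expectation (\<lambda>\<omega>. exp (- R \<omega> * x)))"
  have "has_covariance_function M Z (extended_gneiting \<phi> \<gamma>)"
    unfolding has_covariance_function_def
  proof (intro allI)
    fix i j :: 'm and p q :: "(real ^ 'd) \<times> (real ^ 'l)"
    obtain x t h u where p: "p = (x, t)" and q: "q = (h, u)" by (cases p, cases q)
    define A where "A = (\<lambda>\<omega>. sqrt (2 * R \<omega>) * (\<Omega> \<omega> \<bullet> (x + h)) + norm (\<Omega> \<omega>) / sqrt 2 * W (t + u) \<omega> $ i)"
    define B where "B = (\<lambda>\<omega>. sqrt (2 * R \<omega>) * (\<Omega> \<omega> \<bullet> x) + norm (\<Omega> \<omega>) / sqrt 2 * W t \<omega> $ j)"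
    \<comment> \<open>The field \<open>W\<close> enters \<open>A - B\<close> only through this increment.\<close>
    define D where "D = (\<lambda>\<omega>. W (t + u) \<omega> $ i - W t \<omega> $ j)"
    have AB: "A \<in> borel_measurable (G K)" "B \<in> borel_measurable (G K)"
      if "{0, 1, 4} \<subseteq> K" "K \<subseteq> {..<5}" for K
    proof -
      have [measurable]: "R \<in> borel_measurable (G K)" "\<Omega> \<in> borel_measurable (G K)"
        "\<And>t i. (\<lambda>\<omega>. W t \<omega> $ i) \<in> borel_measurable (G K)"
        using that by (auto intro: G_R G_\<Omega> G_W)
      show "A \<in> borel_measurable (G K)" "B \<in> borel_measurable (G K)"
        unfolding A_def B_def by measurable
    qed
    have indep_U: "indep_rv M borel U (borel \<Otimes>\<^sub>M (borel \<Otimes>\<^sub>M borel)) (\<lambda>\<omega>. (\<Phi> \<omega>, (A \<omega>, B \<omega>)))"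
      by (rule separate[of "{2}" "{0, 1, 3, 4}"]) (auto intro!: G_U G_\<Phi> AB measurable_Pair)
    have indep_\<Phi>: "indep_rv M borel \<Phi> (borel \<Otimes>\<^sub>M borel) (\<lambda>\<omega>. (A \<omega>, B \<omega>))"
      by (rule separate[of "{3}" "{0, 1, 4}"]) (auto intro!: G_\<Phi> AB measurable_Pair)
    have indep_D: "indep_rv M borel D (borel \<Otimes>\<^sub>M borel) (\<lambda>\<omega>. (R \<omega>, \<Omega> \<omega>))"
      unfolding D_def
      by (rule separate[of "{4}" "{0, 1}"])
         (auto intro!: G_R G_\<Omega> G_W measurable_Pair borel_measurable_diff)
    have indep_\<Omega>: "indep_rv M borel \<Omega> borel R"
      by (rule separate[of "{1}" "{0}"]) (auto intro!: G_R G_\<Omega>)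
    have normal: "normal_rv M D"
      unfolding D_def by (rule gaussian_field_difference_normal[OF gaussian])
    have "integrable M (\<lambda>\<omega>. W s \<omega> $ k)" "expectation (\<lambda>\<omega>. W s \<omega> $ k) = 0" for s k
      using centred by (auto simp: centred_field_def)
    then have mean: "expectation D = 0" by (simp add: D_def)
    have \<gamma>: "\<gamma> i j u = variance D / 2"
      using variogram by (simp add: has_pseudo_variogram_def D_def)
    have "A \<omega> - B \<omega> = sqrt (2 * R \<omega>) * (\<Omega> \<omega> \<bullet> h) + norm (\<Omega> \<omega>) / sqrt 2 * D \<omega>" for \<omega>
      by (simp add: A_def B_def D_def inner_add_right algebra_simps)
    then have cov_eq: "expectation (\<lambda>\<omega>. cos (A \<omega> - B \<omega>)) = extended_gneiting \<phi> \<gamma> i j q"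
      using gaussian_mixture_spectral_average[OF R \<Omega> normal mean indep_D indep_\<Omega>, of h]
      by (simp add: q extended_gneiting_def \<gamma> \<phi>_def)
    have "(\<lambda>\<omega>. Z (p + q) \<omega> $ i) = (\<lambda>\<omega>. sqrt (- 2 * ln (U \<omega>)) * cos (A \<omega> + \<Phi> \<omega>))"
      "(\<lambda>\<omega>. Z p \<omega> $ j) = (\<lambda>\<omega>. sqrt (- 2 * ln (U \<omega>)) * cos (B \<omega> + \<Phi> \<omega>))"
      by (simp_all only: p q plus_prod_def fst_conv snd_conv Z A_def B_def)
    then show "cov_exists M (\<lambda>\<omega>. Z (p + q) \<omega> $ i) (\<lambda>\<omega>. Z p \<omega> $ j) \<and>
        cov M (\<lambda>\<omega>. Z (p + q) \<omega> $ i) (\<lambda>\<omega>. Z p \<omega> $ j) = extended_gneiting \<phi> \<gamma> i j q"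
      using random_wave_covariance[OF U \<Phi> indep_U indep_\<Phi>] cov_eq by simp
  qed
  moreover have "bounded_completely_monotone \<phi>"
    unfolding \<phi>_def by (rule laplace_transform_bounded_completely_monotone[OF R])
  ultimately show ?thesis using field by blast
qed

end
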